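(* Let $k\ge 2$ and let $m,r$ be integers with $0\le m\le k$, $0\le r\le k$. If $m+r\ge k-1$, then for the HC-model with any parameter $\lambda>0$ there is a unique AGM (with parameters $m,r$), and it coincides with the unique TIGM.
   Context: Half-tree: let $V$ be the vertex set of the infinite rooted tree with root $x^0$ in which every vertex $x$ has exactly $k$ direct successors, forming the set $S(x)$ (so the root has $k$ nearest neighbours and every other vertex has $k+1$). $W_n$ is the set of vertices at distance $n$ from $x^0$, and $V_n=\bigcup_{j=0}^n W_j$. HC-model (hard-core model): a configuration $\sigma: V\to\{0,1\}$ is admissible if $\sigma(x)\sigma(y)=0$ for all nearest neighbours $x,y$; $\Omega$ (resp. $\Omega_{V_n}$) is the set of admissible configurations on $V$ (resp. $V_n$). For $\sigma_n\in\Omega_{V_n}$, $\#\sigma_n$ is the number of $x\in V_n$ with $\sigma_n(x)=1$. For $\lambda>0$ and a positive function $z: x\mapsto z_x$ on $V$, put $z_{0,x}=1$, $z_{1,x}=z_x$ and $\mu^{(n)}(\sigma_n)=\frac1{Z_n}\lambda^{\#\sigma_n}\prod_{x\in W_n}z_{\sigma_n(x),x}$ on $\Omega_{V_n}$, with $Z_n$ the normalizing constant. If $z_x=\prod_{y\in S(x)}(1+\lambda z_y)^{-1}$ for all $x\in V$, these measures are consistent and define a unique probability measure on $\Omega$ with marginals $\mu^{(n)}$, the (splitting) Gibbs measure corresponding to $z$. It is translation-invariant (a TIGM) if $z_x$ is constant; for each $\lambda>0$ the TIGM exists and is unique. Alternative Gibbs measures (AGM) with parameters $m,r$: consider functions $z$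 taking values in $\{h,l\}$ such that if $z_x=h$ then $z_y=h$ on $m$ vertices $y$ of $S(x)$ and $z_y=l$ on the remaining $k-m$; and if $z_x=l$ then $z_y=l$ on $r$ vertices $y$ of $S(x)$ and $z_y=h$ on the remaining $k-r$. The arrangement (which vertices get the symbol $h$ and which $l$) is fixed. Such $z$ satisfies the equation above when $h>0$, $l>0$ solve $$h=\frac{1}{(1+\lambda h)^m(1+\lambda l)^{k-m}},\qquad l=\frac{1}{(1+\lambda l)^r(1+\lambda h)^{k-r}}.$$ The AGMs are the Gibbs measures corresponding to the solutions $(h,l)$ of this system, one for each solution; solutions with $h=l$ give the TIGM, and solutions with $h\ne l$ give AGMs which are "not TI". *)

theory Defs
  imports "HOL-Probability.Probability"
begin

text \<open>
  The half-tree. A vertex is encoded by the list of branches taken on the path from the root,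
  the last branch first: the root is \<open>[]\<close>, the direct successors of \<open>x\<close> are \<open>i # x\<close> for \<open>i < k\<close>,
  and the distance of \<open>x\<close> from the root is \<open>length x\<close>.
\<close>

definition vertices :: "nat \<Rightarrow> nat list set" where
  "vertices k = {x. set x \<subseteq> {..<k}}"

definition succs :: "nat \<Rightarrow> nat list \<Rightarrow> nat list set" where
  "succs k x = (\<lambda>i. i # x) ` {..<k}"

definition neighbours :: "nat \<Rightarrow> nat list \<Rightarrow> nat list \<Rightarrow> bool" where
  "neighbours k x y \<longleftrightarrow> y \<in> succs k x \<or> x \<in> succs k y"

definition sphere_vertices :: "nat \<Rightarrow> nat \<Rightarrow> nat list set" where
  "sphere_vertices k n = {x \<in> vertices k. length x = n}"

definition ball_vertices :: "nat \<Rightarrow> nat \<Rightarrow> nat list set" where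
  "ball_vertices k n = (\<Union>j\<le>n. sphere_vertices k j)"

text \<open>
  Admissible hard-core configurations on a set \<open>A\<close> of vertices, as extensional functions.
\<close>

definition hc_configs :: "nat \<Rightarrow> nat list set \<Rightarrow> (nat list \<Rightarrow> nat) set" where
  "hc_configs k A =
     {\<sigma> \<in> A \<rightarrow>\<^sub>E {0, 1}. \<forall>x\<in>A. \<forall>y\<in>A. neighbours k x y \<longrightarrow> \<sigma> x * \<sigma> y = 0}"

definition boundary_weight :: "(nat list \<Rightarrow> real) \<Rightarrow> nat \<Rightarrow> nat list \<Rightarrow> real" where
  "boundary_weight z s x = (if s = 0 then 1 else z x)"

definition hc_weight ::
  "nat \<Rightarrow> real \<Rightarrow> (nat list \<Rightarrow> real) \<Rightarrow> nat \<Rightarrow> (nat list \<Rightarrow> nat) \<Rightarrow> real" where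
  "hc_weight k lam z n \<sigma> =
     lam ^ card {x \<in> ball_vertices k n. \<sigma> x = 1} *
     (\<Prod>x\<in>sphere_vertices k n. boundary_weight z (\<sigma> x) x)"

definition hc_marginal ::
  "nat \<Rightarrow> real \<Rightarrow> (nat list \<Rightarrow> real) \<Rightarrow> nat \<Rightarrow> (nat list \<Rightarrow> nat) \<Rightarrow> real" where
  "hc_marginal k lam z n \<sigma> =
     hc_weight k lam z n \<sigma> / (\<Sum>\<tau>\<in>hc_configs k (ball_vertices k n). hc_weight k lam z n \<tau>)"

definition compatible :: "nat \<Rightarrow> real \<Rightarrow> (nat list \<Rightarrow> real) \<Rightarrow> bool" where
  "compatible k lam z \<longleftrightarrow>
     (\<forall>x\<in>vertices k. z x > 0 \<and> z x = (\<Prod>y\<in>succs k x. inverse (1 + lam * z y)))"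

text \<open>
  The measure lives on the set of admissible configurations of the whole tree, with the trace of
  the product (cylinder) sigma-algebra.
\<close>

definition is_gibbs ::
  "nat \<Rightarrow> real \<Rightarrow> (nat list \<Rightarrow> real) \<Rightarrow> (nat list \<Rightarrow> nat) measure \<Rightarrow> bool" where
  "is_gibbs k lam z \<mu> \<longleftrightarrow>
     compatible k lam z \<and>
     prob_space \<mu> \<and>
     sets \<mu> = sets (restrict_space (\<Pi>\<^sub>M x\<in>vertices k. count_space {0, 1})
                                  (hc_configs k (vertices k))) \<and>
     (\<forall>n. \<forall>\<sigma>\<in>hc_configs k (ball_vertices k n).
        measure \<mu> {\<omega> \<in> space \<mu>. restrict \<omega> (ball_vertices k n) = \<sigma>} = hc_marginal k lam z n \<sigma>)"

definition TIGMs :: "nat \<Rightarrow> real \<Rightarrow> (nat list \<Rightarrow> nat) measure set" where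
  "TIGMs k lam = {\<mu>. \<exists>z. (\<exists>c. \<forall>x\<in>vertices k. z x = c) \<and> is_gibbs k lam z \<mu>}"

text \<open>
  An arrangement places the symbols h (\<open>True\<close>) and l (\<open>False\<close>) on the vertices. It is kept
  separate from the numerical values of h and l, so that it also makes sense when they are equal.
\<close>

definition arrangement :: "nat \<Rightarrow> nat \<Rightarrow> nat \<Rightarrow> (nat list \<Rightarrow> bool) \<Rightarrow> bool" where
  "arrangement k m r a \<longleftrightarrow>
     (\<forall>x\<in>vertices k.
        (a x \<longrightarrow> card {y \<in> succs k x. a y} = m \<and> card {y \<in> succs k x. \<not> a y} = k - m) \<and>
        (\<not> a x \<longrightarrow> card {y \<in> succs k x. \<not> a y} = r \<and> card {y \<in> succs k x. a y} = k - r))"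

definition AGM_solutions :: "nat \<Rightarrow> nat \<Rightarrow> nat \<Rightarrow> real \<Rightarrow> (real \<times> real) set" where
  "AGM_solutions k m r lam =
     {(h, l). h > 0 \<and> l > 0 \<and>
        h = 1 / ((1 + lam * h) ^ m * (1 + lam * l) ^ (k - m)) \<and>
        l = 1 / ((1 + lam * l) ^ r * (1 + lam * h) ^ (k - r))}"

definition AGMs ::
  "nat \<Rightarrow> nat \<Rightarrow> nat \<Rightarrow> real \<Rightarrow> (nat list \<Rightarrow> bool) \<Rightarrow> (nat list \<Rightarrow> nat) measure set" where
  "AGMs k m r lam a =
     {\<mu>. \<exists>(h, l)\<in>AGM_solutions k m r lam. is_gibbs k lam (\<lambda>x. if a x then h else l) \<mu>}"

text \<open>
  Arrangements exist for all admissible parameters, with either symbol at the root.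
\<close>

lemma ex_arrangement:
  assumes "m \<le> k" "r \<le> k"
  shows "\<exists>a. arrangement k m r a \<and> a [] = b"
proof -
  define a where "a = rec_list b (\<lambda>i _ c. if c then i < m else r \<le> i)"
  have a: "a [] = b" "a (i # x) = (if a x then i < m else r \<le> i)" for i x
    by (simp_all add: a_def)
  have card_succs: "card {y \<in> succs k x. P y} = card {i. i < k \<and> P (i # x)}" for P x
  proof -
    have "{y \<in> succs k x. P y} = (\<lambda>i. i # x) ` {i. i < k \<and> P (i # x)}"
      by (auto simp: succs_def)
    then show ?thesis by (simp add: card_image inj_on_def)
  qed
  have lo: "card {i. i < k \<and> i < n} = n" if "n \<le> k" for n
  proof -
    have "{i. i < k \<and> i < n} = {..<n}" using that by auto
    then show ?thesis by simp
  qed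
  have hi: "card {i. i < k \<and> n \<le> i} = k - n" for n
  proof -
    have "{i. i < k \<and> n \<le> i} = {n..<k}" by auto
    then show ?thesis by simp
  qed
  have "arrangement k m r a"
    unfolding arrangement_def card_succs using assms by (auto simp: a lo hi not_less not_le)
  with a(1) show ?thesis by blast
qed

end

theory Submission imports Defs begin

text \<open>
  The statement has an algebraic half and a probabilistic half.

  Algebra. Dividing the two equations of the system gives
  \<open>h / l = ((1 + \<lambda>l) / (1 + \<lambda>h)) ^ (m + r - k)\<close>. If \<open>m + r \<ge> k\<close> and \<open>h > l\<close>, the left side
  exceeds 1 and the right side does not. If \<open>m + r = k - 1\<close>, the equation reads
  \<open>h (1 + \<lambda>l) = l (1 + \<lambda>h)\<close>, that is, \<open>h = l\<close>. As the system is symmetric under exchanging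
  \<open>(h, m)\<close> with \<open>(l, r)\<close>, this excludes \<open>h \<noteq> l\<close> (\<open>system_solution_not_less\<close>). On the diagonal both
  equations become \<open>c (1 + \<lambda>c) ^ k = 1\<close>, whose left side increases strictly from 0, so there is
  exactly one positive solution (\<open>ex1_constant_law\<close>). The same equation characterises the constant
  boundary laws, so AGMs and TIGMs are both the Gibbs measures of the constant law \<open>c\<close>.

  Probability. Every boundary law \<open>z\<close> has exactly one Gibbs measure. It is unique because the
  cylinders over balls are closed under intersection, generate the sigma-algebra, and have measures
  prescribed by the marginals (\<open>is_gibbs_unique\<close>). It exists by an explicit construction
  (\<open>ex_is_gibbs\<close>): a splitting Gibbs measure is a Markov chain along the tree, in which a vertex
  below an occupied parent is empty, and any other vertex \<open>x\<close> is occupied with probability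
  \<open>\<lambda>z\<^sub>x / (1 + \<lambda>z\<^sub>x)\<close>. Toss independent coins with these probabilities and read the spins off from
  the root downwards, ignoring the coins of blocked vertices. A cylinder event is then a box in the
  product space, so its probability is a finite product. The equation for \<open>z\<close> turns this product
  into the Gibbs weight up to a constant (\<open>prod_spin_prob\<close>), and since the cylinder probabilities
  sum to 1 that constant is the inverse of the partition function.
\<close>

section \<open>Balls and spheres of the half-tree\<close>

lemma Nil_in_vertices [simp]: "[] \<in> vertices k"
  by (simp add: vertices_def)

lemma Cons_in_vertices_iff [simp]: "i # x \<in> vertices k \<longleftrightarrow> i < k \<and> x \<in> vertices k"
  by (auto simp: vertices_def)

lemma in_ball_vertices_iff: "x \<in> ball_vertices k n \<longleftrightarrow> x \<in> vertices k \<and> length x \<le> n"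
  by (auto simp: ball_vertices_def sphere_vertices_def)

lemma ball_vertices_subset: "ball_vertices k n \<subseteq> vertices k"
  by (auto simp: in_ball_vertices_iff)

lemma sphere_vertices_subset: "sphere_vertices k n \<subseteq> vertices k"
  by (auto simp: sphere_vertices_def)

lemma succs_subset: "x \<in> vertices k \<Longrightarrow> succs k x \<subseteq> vertices k"
  by (auto simp: succs_def)

lemma finite_sphere_vertices [simp]: "finite (sphere_vertices k n)"
  unfolding sphere_vertices_def vertices_def
  using finite_lists_length_eq[of "{..<k}" n] by simp

lemma finite_ball_vertices [simp]: "finite (ball_vertices k n)"
  by (simp add: ball_vertices_def)

lemma sphere_vertices_0: "sphere_vertices k 0 = {[]}"
  by (auto simp: sphere_vertices_def)

lemma ball_vertices_0: "ball_vertices k 0 = {[]}"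
  by (auto simp: in_ball_vertices_iff)

lemma sphere_vertices_Suc:
  "sphere_vertices k (Suc n) = (\<lambda>(x, i). i # x) ` (sphere_vertices k n \<times> {..<k})"
  by (auto simp: sphere_vertices_def length_Suc_conv image_iff)

lemma ball_vertices_Suc:
  "ball_vertices k (Suc n) = ball_vertices k n \<union> sphere_vertices k (Suc n)"
  by (auto simp: in_ball_vertices_iff sphere_vertices_def)

lemma ball_sphere_disjoint: "ball_vertices k n \<inter> sphere_vertices k (Suc n) = {}"
  by (auto simp: in_ball_vertices_iff sphere_vertices_def)

lemma prod_sphere_vertices_Suc:
  "(\<Prod>x\<in>sphere_vertices k (Suc n). f x) = (\<Prod>x\<in>sphere_vertices k n. \<Prod>i<k. f (i # x))"
  unfolding sphere_vertices_Suc
  by (subst prod.reindex) (auto simp: inj_on_def prod.cartesian_product case_prod_unfold)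

lemma prod_succs: "(\<Prod>y\<in>succs k x. f y) = (\<Prod>i<k. f (i # x))"
  unfolding succs_def by (subst prod.reindex) (auto simp: inj_on_def)

section \<open>Admissible configurations and cylinders\<close>

text \<open>
  The vanishing product on neighbours, oriented from parent to child: this is the form that suits
  inductions from the root.
\<close>

lemma hc_configs_iff:
  "\<sigma> \<in> hc_configs k A \<longleftrightarrow>
     \<sigma> \<in> A \<rightarrow>\<^sub>E {0, 1} \<and> (\<forall>i<k. \<forall>x. x \<in> A \<longrightarrow> i # x \<in> A \<longrightarrow> \<sigma> x = 1 \<longrightarrow> \<sigma> (i # x) = 0)"
  (is "?L \<longleftrightarrow> ?R")
proof
  assume ?L
  then show ?R
    unfolding hc_configs_def neighbours_def succs_def by fastforce
next
  assume R: ?R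
  have *: "\<sigma> x = 0 \<or> \<sigma> (i # x) = 0" if "i < k" "x \<in> A" "i # x \<in> A" for i x
  proof -
    have "\<sigma> x \<in> {0, 1}" using R that by blast
    then show ?thesis using R that by auto
  qed
  have "\<sigma> x * \<sigma> y = 0" if "x \<in> A" "y \<in> A" "neighbours k x y" for x y
    using that *[of _ x] *[of _ y] unfolding neighbours_def succs_def by fastforce
  then show ?L
    using R by (simp add: hc_configs_def)
qed

lemma finite_hc_configs: "finite A \<Longrightarrow> finite (hc_configs k A)"
  unfolding hc_configs_def by (simp add: finite_PiE)

lemma restrict_hc_configs:
  assumes "\<sigma> \<in> hc_configs k B" "A \<subseteq> B"
  shows "restrict \<sigma> A \<in> hc_configs k A"
  using assms unfolding hc_configs_iff PiE_iff
  by (simp add: subset_iff)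

lemma hc_configs_value: "\<sigma> \<in> hc_configs k A \<Longrightarrow> x \<in> A \<Longrightarrow> \<sigma> x = 0 \<or> \<sigma> x = 1"
  by (auto simp: hc_configs_iff PiE_iff)

definition cylinder :: "nat \<Rightarrow> nat \<Rightarrow> (nat list \<Rightarrow> nat) \<Rightarrow> (nat list \<Rightarrow> nat) set" where
  "cylinder k n \<sigma> = {\<omega> \<in> hc_configs k (vertices k). restrict \<omega> (ball_vertices k n) = \<sigma>}"

definition config_space :: "nat \<Rightarrow> (nat list \<Rightarrow> nat) measure" where
  "config_space k =
     restrict_space (\<Pi>\<^sub>M x\<in>vertices k. count_space {0, 1}) (hc_configs k (vertices k))"

lemma space_config_space: "space (config_space k) = hc_configs k (vertices k)"
  by (auto simp: config_space_def space_restrict_space space_PiM hc_configs_def)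

lemma cylinder_eq:
  assumes "\<sigma> \<in> hc_configs k (ball_vertices k n)"
  shows "cylinder k n \<sigma> =
    {\<omega> \<in> hc_configs k (vertices k). \<forall>x\<in>ball_vertices k n. \<omega> x = \<sigma> x}"
proof -
  have "\<sigma> \<in> extensional (ball_vertices k n)"
    using assms by (simp add: hc_configs_iff PiE_iff)
  then have "restrict \<omega> (ball_vertices k n) = \<sigma> \<longleftrightarrow> (\<forall>x\<in>ball_vertices k n. \<omega> x = \<sigma> x)" for \<omega>
    by (auto simp: fun_eq_iff extensional_def restrict_def)
  then show ?thesis by (simp add: cylinder_def)
qed

lemma cylinder_in_sets:
  assumes "\<sigma> \<in> hc_configs k (ball_vertices k n)"
  shows "cylinder k n \<sigma> \<in> sets (config_space k)"
proof -
  have "{\<omega> \<in> space (config_space k). \<forall>x\<in>ball_vertices k n. \<omega> x = \<sigma> x} \<in> sets (config_space k)"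
  proof (rule sets.sets_Collect_finite_All)
    fix x assume x: "x \<in> ball_vertices k n"
    then have "(\<lambda>\<omega>. \<omega> x) \<in> measurable (config_space k) (count_space {0, 1})"
      using ball_vertices_subset unfolding config_space_def
      by (intro measurable_restrict_space1 measurable_component_singleton) auto
    then have "(\<lambda>\<omega>. \<omega> x) -` {\<sigma> x} \<inter> space (config_space k) \<in> sets (config_space k)"
      by (rule measurable_sets) (use hc_configs_value[OF assms x] in auto)
    then show "{\<omega> \<in> space (config_space k). \<omega> x = \<sigma> x} \<in> sets (config_space k)"
      by (simp add: vimage_def Int_def conj_commute)
  qed simp
  then show ?thesis
    by (simp add: cylinder_eq[OF assms] space_config_space)
qed

definition cylinders :: "nat \<Rightarrow> (nat list \<Rightarrow> nat) set set" where
  "cylinders k = insert {} {cylinder k n \<sigma> | n \<sigma>. \<sigma> \<in> hc_configs k (ball_vertices k n)}"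

text \<open>
  A ball configuration determines the configuration on every smaller ball, so two cylinders are
  either nested or disjoint. The empty set is included in \<open>cylinders\<close> for the second case.
\<close>

lemma Int_stable_cylinders: "Int_stable (cylinders k)"
proof -
  have nested: "cylinder k n \<sigma> \<inter> cylinder k p \<tau> \<in> {{}, cylinder k p \<tau>}" if "n \<le> p" for n p \<sigma> \<tau>
  proof -
    have "restrict (restrict \<omega> (ball_vertices k p)) (ball_vertices k n) = restrict \<omega> (ball_vertices k n)"
      for \<omega> :: "nat list \<Rightarrow> nat"
      using that by (auto simp: fun_eq_iff restrict_def in_ball_vertices_iff)
    then have "restrict \<omega> (ball_vertices k n) = restrict \<tau> (ball_vertices k n)"
      if "\<omega> \<in> cylinder k p \<tau>" for \<omega>
      using that by (auto simp: cylinder_def)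
    then show ?thesis by (auto simp: cylinder_def)
  qed
  show ?thesis
    unfolding Int_stable_def
  proof (intro ballI)
    fix A B assume A: "A \<in> cylinders k" and B: "B \<in> cylinders k"
    show "A \<inter> B \<in> cylinders k"
    proof (cases "A = {} \<or> B = {}")
      case True then show ?thesis by (auto simp: cylinders_def)
    next
      case False
      then obtain n \<sigma> p \<tau> where "A = cylinder k n \<sigma>" "B = cylinder k p \<tau>"
        using A B by (auto simp: cylinders_def)
      then have "A \<inter> B \<in> {{}, A, B}"
        using nested[of n p \<sigma> \<tau>] nested[of p n \<tau> \<sigma>] by (cases "n \<le> p") auto
      then show ?thesis using A B by (auto simp: cylinders_def)
    qed
  qed
qed

lemma cylinders_subset: "cylinders k \<subseteq> Pow (hc_configs k (vertices k))"
  by (auto simp: cylinders_def cylinder_def)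

text \<open>
  A spin at \<open>x\<close> is determined by the configuration on the ball reaching down to \<open>x\<close>. That ball
  carries finitely many configurations, so each event about one spin is a finite union of cylinders;
  these events generate the trace of the product sigma-algebra.
\<close>

lemma sets_config_space: "sets (config_space k) = sigma_sets (hc_configs k (vertices k)) (cylinders k)"
proof (rule antisym)
  let ?S = "sigma (hc_configs k (vertices k)) (cylinders k)"
  have coord: "(\<lambda>\<omega>. \<omega> x) \<in> measurable ?S (count_space {0, 1})" if x: "x \<in> vertices k" for x
  proof (rule measurable_count_space_eq2[THEN iffD2])
    have "(\<lambda>\<omega>. \<omega> x) -` {s} \<inter> space ?S \<in> sets ?S" for s
    proof -
      let ?B = "ball_vertices k (length x)"
      have xB: "x \<in> ?B" using x by (simp add: in_ball_vertices_iff)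
      have "(\<lambda>\<omega>. \<omega> x) -` {s} \<inter> hc_configs k (vertices k) =
          (\<Union>\<sigma>\<in>{\<sigma> \<in> hc_configs k ?B. \<sigma> x = s}. cylinder k (length x) \<sigma>)"
        using xB restrict_hc_configs[OF _ ball_vertices_subset] by (auto simp: cylinder_def)
      also have "\<dots> \<in> sets ?S"
        using cylinders_subset
        by (intro sets.finite_UN) (auto simp: finite_hc_configs cylinders_def)
      finally show ?thesis using cylinders_subset by simp
    qed
    then show "(\<lambda>\<omega>. \<omega> x) \<in> space ?S \<rightarrow> {0, 1} \<and>
        (\<forall>s\<in>{0, 1}. (\<lambda>\<omega>. \<omega> x) -` {s} \<inter> space ?S \<in> sets ?S)"
      using x hc_configs_value cylinders_subset by fastforce
  qed simp
  have "(\<lambda>\<omega>. \<omega>) \<in> measurable ?S (config_space k)"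
    unfolding config_space_def
  proof (intro measurable_restrict_space2 measurable_PiM_single')
    show "(\<lambda>\<omega>. \<omega>) \<in> space ?S \<rightarrow> hc_configs k (vertices k)"
      using cylinders_subset by simp
    show "(\<lambda>\<omega> i. \<omega> i) \<in> space ?S \<rightarrow> (\<Pi>\<^sub>E i\<in>vertices k. space (count_space {0, 1}))"
      using cylinders_subset by (auto simp: hc_configs_def)
  qed (rule coord)
  then have "A \<in> sets ?S" if "A \<in> sets (config_space k)" for A
    using measurable_sets[of "\<lambda>\<omega>. \<omega>" ?S "config_space k" A] that sets.sets_into_space[OF that]
      cylinders_subset[of k]
    by (simp add: space_config_space Int_absorb2)
  then show "sets (config_space k) \<subseteq> sigma_sets (hc_configs k (vertices k)) (cylinders k)"
    using cylinders_subset by auto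
next
  have "cylinders k \<subseteq> sets (config_space k)"
    using cylinder_in_sets by (auto simp: cylinders_def)
  then show "sigma_sets (hc_configs k (vertices k)) (cylinders k) \<subseteq> sets (config_space k)"
    using sets.sigma_sets_subset[of "cylinders k" "config_space k"] by (simp add: space_config_space)
qed

section \<open>Uniqueness of the Gibbs measure of a boundary law\<close>

text \<open>
  The marginals fix the measure of every cylinder, and the cylinders form a generator that is stable
  under intersection. The cylinders over the root alone exhaust the space, which supplies the
  countable cover of finite measure that the uniqueness theorem for measures asks for.
\<close>

lemma is_gibbs_unique:
  assumes \<mu>: "is_gibbs k lam z \<mu>" and \<nu>: "is_gibbs k lam z \<nu>"
  shows "\<mu> = \<nu>"
proof -
  interpret \<mu>: prob_space \<mu> using \<mu> by (simp add: is_gibbs_def)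
  interpret \<nu>: prob_space \<nu> using \<nu> by (simp add: is_gibbs_def)
  have sets: "sets \<mu> = sets (config_space k)" "sets \<nu> = sets (config_space k)"
    using \<mu> \<nu> unfolding is_gibbs_def config_space_def by blast+
  have space: "space \<mu> = hc_configs k (vertices k)" "space \<nu> = hc_configs k (vertices k)"
    using sets[THEN sets_eq_imp_space_eq] by (simp_all only: space_config_space)
  have eq: "emeasure \<mu> A = emeasure \<nu> A" if "A \<in> cylinders k" for A
    using that \<mu> \<nu>
    by (auto simp: cylinders_def cylinder_def is_gibbs_def space \<mu>.emeasure_eq_measure
        \<nu>.emeasure_eq_measure)
  let ?A = "cylinder k 0 ` hc_configs k (ball_vertices k 0)"
  show ?thesis
  proof (rule measure_eqI_generator_eq_countable[OF Int_stable_cylinders cylinders_subset eq])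
    show "\<Union>?A = hc_configs k (vertices k)"
      using restrict_hc_configs[OF _ ball_vertices_subset] by (auto simp: cylinder_def)
    show "countable ?A"
      by (simp add: countable_finite finite_hc_configs)
  qed (auto simp: sets sets_config_space cylinders_def)
qed

section \<open>Existence: thinning a field of independent coins\<close>

primrec occupied :: "(nat list \<Rightarrow> bool) \<Rightarrow> nat list \<Rightarrow> bool" where
  "occupied \<omega> [] \<longleftrightarrow> \<omega> []"
| "occupied \<omega> (i # x) \<longleftrightarrow> \<omega> (i # x) \<and> \<not> occupied \<omega> x"

text \<open>
  Extensional outside the tree, so that the configuration lies in the product space over
  \<open>vertices k\<close>.
\<close>

definition thinned :: "nat \<Rightarrow> (nat list \<Rightarrow> bool) \<Rightarrow> nat list \<Rightarrow> nat" where
  "thinned k \<omega> = (\<lambda>x\<in>vertices k. of_bool (occupied \<omega> x))"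

definition blocked :: "(nat list \<Rightarrow> nat) \<Rightarrow> nat list \<Rightarrow> bool" where
  "blocked \<sigma> x \<longleftrightarrow> x \<noteq> [] \<and> \<sigma> (tl x) = 1"

lemma thinned_hc_configs: "thinned k \<omega> \<in> hc_configs k (vertices k)"
  unfolding hc_configs_iff by (auto simp: thinned_def)

text \<open>
  The conditional probability, in the Markov chain along the tree, that \<open>x\<close> has spin \<open>\<sigma> x\<close> given
  the spin of its parent. In a blocked vertex the value 1 is right only for \<open>\<sigma> x = 0\<close>, which
  admissibility of \<open>\<sigma>\<close> guarantees.
\<close>

definition spin_prob :: "real \<Rightarrow> (nat list \<Rightarrow> real) \<Rightarrow> (nat list \<Rightarrow> nat) \<Rightarrow> nat list \<Rightarrow> real" where
  "spin_prob lam z \<sigma> x =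
     (if blocked \<sigma> x then 1
      else if \<sigma> x = 1 then lam * z x / (1 + lam * z x) else 1 / (1 + lam * z x))"

definition coins :: "nat \<Rightarrow> real \<Rightarrow> (nat list \<Rightarrow> real) \<Rightarrow> (nat list \<Rightarrow> bool) measure" where
  "coins k lam z =
     (\<Pi>\<^sub>M x\<in>vertices k. measure_pmf (bernoulli_pmf (lam * z x / (1 + lam * z x))))"

lemma prob_space_coins: "prob_space (coins k lam z)"
  unfolding coins_def by (intro prob_space_PiM prob_space_measure_pmf)

lemma measurable_occupied:
  "x \<in> vertices k \<Longrightarrow> Measurable.pred (coins k lam z) (\<lambda>\<omega>. occupied \<omega> x)"
proof (induction x)
  have coord: "Measurable.pred (coins k lam z) (\<lambda>\<omega>. \<omega> x)" if "x \<in> vertices k" for x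
    unfolding coins_def
    using measurable_component_singleton[OF that,
        of "\<lambda>x. measure_pmf (bernoulli_pmf (lam * z x / (1 + lam * z x)))"]
    by (simp add: measurable_def)
  {
    case Nil
    then show ?case using coord by simp
  next
    case (Cons i x)
    then show ?case using coord[of "i # x"] by simp
  }
qed

lemma measurable_thinned: "thinned k \<in> measurable (coins k lam z) (config_space k)"
  unfolding config_space_def
proof (rule measurable_restrict_space2)
  show "thinned k \<in> space (coins k lam z) \<rightarrow> hc_configs k (vertices k)"
    using thinned_hc_configs by auto
  have "(\<lambda>\<omega>. of_bool (occupied \<omega> x)) \<in> measurable (coins k lam z) (count_space {0, 1 :: nat})"
    if "x \<in> vertices k" for x
    using measurable_occupied[OF that]
    by (rule measurable_compose) auto
  then show "thinned k \<in> measurable (coins k lam z) (\<Pi>\<^sub>M x\<in>vertices k. count_space {0, 1})"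
    unfolding thinned_def by (intro measurable_restrict) auto
qed

text \<open>
  Going down from the root, once the parent of \<open>x\<close> has the prescribed spin, the coin at \<open>x\<close> either is
  irrelevant (\<open>x\<close> is blocked) or must equal the prescribed spin. So the blocked vertices can be read
  off from \<open>\<sigma>\<close> instead of \<open>\<omega>\<close>, and the event constrains the coins separately: it is a box.
\<close>

lemma thinned_in_cylinder_iff:
  assumes \<sigma>: "\<sigma> \<in> hc_configs k (ball_vertices k n)"
  shows "thinned k \<omega> \<in> cylinder k n \<sigma> \<longleftrightarrow>
    (\<forall>x\<in>ball_vertices k n. blocked \<sigma> x \<or> \<omega> x = (\<sigma> x = 1))"
    (is "_ \<longleftrightarrow> ?R")
proof -
  let ?B = "ball_vertices k n"
  have "thinned k \<omega> \<in> cylinder k n \<sigma> \<longleftrightarrow> (\<forall>x\<in>?B. occupied \<omega> x = (\<sigma> x = 1))"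
    unfolding cylinder_eq[OF \<sigma>]
    using hc_configs_value[OF \<sigma>] thinned_hc_configs[of k \<omega>] ball_vertices_subset[of k n]
    by (force simp: thinned_def)
  also have "\<dots> \<longleftrightarrow> ?R"
  proof
    assume *: "\<forall>x\<in>?B. occupied \<omega> x = (\<sigma> x = 1)"
    have "\<omega> x = (\<sigma> x = 1)" if x: "x \<in> ?B" "\<not> blocked \<sigma> x" for x
    proof (cases x)
      case Nil then show ?thesis using * x by force
    next
      case (Cons i y)
      then have "y \<in> ?B" using x by (auto simp: in_ball_vertices_iff)
      then show ?thesis
        using *[rule_format, of x] *[rule_format, of y] x Cons by (simp add: blocked_def)
    qed
    then show ?R by blast
  next
    assume R: ?R
    have "occupied \<omega> x = (\<sigma> x = 1)" if "x \<in> ?B" for x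
      using that
    proof (induction x)
      case Nil then show ?case using R by (force simp: blocked_def)
    next
      case (Cons i y)
      then have y: "y \<in> ?B" "i < k" by (auto simp: in_ball_vertices_iff)
      with Cons have IH: "occupied \<omega> y = (\<sigma> y = 1)" by simp
      show ?case
      proof (cases "\<sigma> y = 1")
        case True
        then have "\<sigma> (i # y) = 0" using \<sigma> y Cons.prems by (simp add: hc_configs_iff)
        then show ?thesis using IH True by simp
      next
        case False
        then show ?thesis using IH R Cons.prems by (force simp: blocked_def)
      qed
    qed
    then show "\<forall>x\<in>?B. occupied \<omega> x = (\<sigma> x = 1)" by blast
  qed
  finally show ?thesis .
qed

text \<open>The product measure of the box of \<open>thinned_in_cylinder_iff\<close>.\<close>

lemma measure_thinned_cylinder:
  assumes \<sigma>: "\<sigma> \<in> hc_configs k (ball_vertices k n)"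
    and "lam > 0" and z: "\<And>x. x \<in> vertices k \<Longrightarrow> z x > 0"
  shows "measure (distr (coins k lam z) (config_space k) (thinned k)) (cylinder k n \<sigma>) =
    (\<Prod>x\<in>ball_vertices k n. spin_prob lam z \<sigma> x)"
proof -
  let ?B = "ball_vertices k n"
  let ?p = "\<lambda>x. lam * z x / (1 + lam * z x)"
  let ?M = "\<lambda>x. measure_pmf (bernoulli_pmf (?p x))"
  interpret product_prob_space ?M "vertices k" ..
  define X where "X x = (if blocked \<sigma> x then UNIV else {\<sigma> x = 1})" for x
  have "measure (distr (coins k lam z) (config_space k) (thinned k)) (cylinder k n \<sigma>) =
      measure (coins k lam z) (thinned k -` cylinder k n \<sigma> \<inter> space (coins k lam z))"
    by (rule measure_distr[OF measurable_thinned cylinder_in_sets[OF \<sigma>]])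
  also have "thinned k -` cylinder k n \<sigma> \<inter> space (coins k lam z) =
      prod_emb (vertices k) ?M ?B (\<Pi>\<^sub>E x\<in>?B. X x)"
    unfolding prod_emb_def coins_def space_PiM
    using ball_vertices_subset[of k n]
    by (auto simp: thinned_in_cylinder_iff[OF \<sigma>] X_def PiE_iff split: if_splits)
  also have "measure (coins k lam z) \<dots> = (\<Prod>x\<in>?B. measure (?M x) (X x))"
    unfolding coins_def using ball_vertices_subset by (intro measure_PiM_emb) auto
  also have "\<dots> = (\<Prod>x\<in>?B. spin_prob lam z \<sigma> x)"
  proof (rule prod.cong)
    fix x assume "x \<in> ?B"
    then have "lam * z x > 0"
      using z ball_vertices_subset \<open>lam > 0\<close> by (auto simp: subset_iff)
    then have "0 \<le> ?p x" "?p x \<le> 1" "1 - ?p x = 1 / (1 + lam * z x)"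
      by (auto simp: field_simps)
    then show "measure (?M x) (X x) = spin_prob lam z \<sigma> x"
      by (auto simp: X_def spin_prob_def measure_pmf_single)
  qed simp
  finally show ?thesis .
qed

section \<open>The thinned field has the prescribed marginals\<close>

lemma boundary_weight_pos:
  "z x > 0 \<Longrightarrow> boundary_weight z s x > 0"
  by (simp add: boundary_weight_def)

text \<open>
  Passing from level \<open>n\<close> to \<open>n + 1\<close> replaces the boundary factors on the old sphere by activities
  and boundary factors on the new one. The old factors stand on the left side, so that no division
  occurs.
\<close>

lemma hc_weight_Suc:
  "hc_weight k lam z (Suc n) \<sigma> * (\<Prod>y\<in>sphere_vertices k n. boundary_weight z (\<sigma> y) y) =
    hc_weight k lam z n \<sigma> *
    (\<Prod>y\<in>sphere_vertices k n. \<Prod>i<k.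
       (if \<sigma> (i # y) = 1 then lam else 1) * boundary_weight z (\<sigma> (i # y)) (i # y))"
proof -
  let ?W = "sphere_vertices k (Suc n)"
  have pow: "lam ^ card {x \<in> A. \<sigma> x = 1} = (\<Prod>x\<in>A. if \<sigma> x = 1 then lam else 1)"
    if "finite A" for A
    using that by (simp add: prod.If_cases Int_def)
  have "hc_weight k lam z (Suc n) \<sigma> =
      (\<Prod>x\<in>ball_vertices k n. if \<sigma> x = 1 then lam else 1) *
      ((\<Prod>x\<in>?W. if \<sigma> x = 1 then lam else 1) * (\<Prod>x\<in>?W. boundary_weight z (\<sigma> x) x))"
    unfolding hc_weight_def pow[OF finite_ball_vertices]
    by (simp add: ball_vertices_Suc prod.union_disjoint ball_sphere_disjoint mult.assoc)
  also have "\<dots> = (\<Prod>x\<in>ball_vertices k n. if \<sigma> x = 1 then lam else 1) *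
      (\<Prod>y\<in>sphere_vertices k n. \<Prod>i<k.
         (if \<sigma> (i # y) = 1 then lam else 1) * boundary_weight z (\<sigma> (i # y)) (i # y))"
    by (simp only: prod.distrib[symmetric] prod_sphere_vertices_Suc)
  finally show ?thesis
    unfolding hc_weight_def[of k lam z n] pow[OF finite_ball_vertices] by (simp only: mult_ac)
qed

text \<open>
  Where the defining equation of a boundary law enters. The children of an empty vertex \<open>y\<close>
  contribute the normalising factors \<open>1 / (1 + \<lambda>z)\<close>, whose product is \<open>z y\<close>; the children of an
  occupied \<open>y\<close> contribute 1, which equals \<open>z y\<close> divided by the boundary factor \<open>z y\<close> that \<open>y\<close> had
  as a vertex of the sphere. In both cases the new level costs the same factor \<open>z y\<close>, whatever the
  configuration. The constant thus is \<open>1 / (1 + \<lambda>z)\<close> at the root, times the product of \<open>z\<close> over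
  the vertices at distance less than \<open>n\<close>.
\<close>

lemma prod_spin_prob:
  assumes z: "compatible k lam z" and lam: "lam > 0"
  shows "\<exists>C. \<forall>\<sigma>\<in>hc_configs k (vertices k).
    (\<Prod>x\<in>ball_vertices k n. spin_prob lam z \<sigma> x) = C * hc_weight k lam z n \<sigma>"
proof (induction n)
  have zpos: "z x > 0" if "x \<in> vertices k" for x
    using z that unfolding compatible_def by blast
  {
    case 0
    have "{x. x = [] \<and> \<sigma> x = Suc 0} = (if \<sigma> [] = 1 then {[]} else {})"
      for \<sigma> :: "nat list \<Rightarrow> nat" by auto
    then have "(\<Prod>x\<in>ball_vertices k 0. spin_prob lam z \<sigma> x) =
        1 / (1 + lam * z []) * hc_weight k lam z 0 \<sigma>"
      if "\<sigma> \<in> hc_configs k (vertices k)" for \<sigma>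
      using hc_configs_value[OF that, of "[]"]
      by (auto simp: hc_weight_def ball_vertices_0 sphere_vertices_0 spin_prob_def blocked_def
          boundary_weight_def)
    then show ?case by blast
  next
    case (Suc n)
    let ?W = "sphere_vertices k n"
    obtain C where C: "\<And>\<sigma>. \<sigma> \<in> hc_configs k (vertices k) \<Longrightarrow>
        (\<Prod>x\<in>ball_vertices k n. spin_prob lam z \<sigma> x) = C * hc_weight k lam z n \<sigma>"
      using Suc by blast
    have "(\<Prod>x\<in>ball_vertices k (Suc n). spin_prob lam z \<sigma> x) =
        C * (\<Prod>y\<in>?W. z y) * hc_weight k lam z (Suc n) \<sigma>"
      if \<sigma>: "\<sigma> \<in> hc_configs k (vertices k)" for \<sigma>
    proof -
      let ?b = "\<lambda>x. boundary_weight z (\<sigma> x) x"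
      let ?f = "\<lambda>x. (if \<sigma> x = 1 then lam else 1) * ?b x"
      have family: "(\<Prod>i<k. spin_prob lam z \<sigma> (i # y)) * ?b y = z y * (\<Prod>i<k. ?f (i # y))"
        if y: "y \<in> vertices k" for y
      proof (cases "\<sigma> y = 1")
        case True
        have "\<sigma> (i # y) = 0" if "i < k" for i
          using \<sigma> that y True by (simp add: hc_configs_iff)
        then show ?thesis
          using True by (simp add: spin_prob_def blocked_def boundary_weight_def)
      next
        case False
        then have "\<sigma> y = 0" using hc_configs_value[OF \<sigma> y] by simp
        moreover have "spin_prob lam z \<sigma> (i # y) = inverse (1 + lam * z (i # y)) * ?f (i # y)"
          if "i < k" for i
          using False hc_configs_value[OF \<sigma>, of "i # y"] that y
          by (auto simp: spin_prob_def blocked_def boundary_weight_def divide_inverse)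
        moreover have "z y = (\<Prod>i<k. inverse (1 + lam * z (i # y)))"
          using z y by (simp add: compatible_def prod_succs)
        ultimately show ?thesis
          by (simp add: prod.distrib boundary_weight_def)
      qed
      have pos: "(\<Prod>y\<in>?W. ?b y) > 0"
        using sphere_vertices_subset zpos by (intro prod_pos ballI boundary_weight_pos) auto
      have "(\<Prod>x\<in>ball_vertices k (Suc n). spin_prob lam z \<sigma> x) * (\<Prod>y\<in>?W. ?b y) =
          C * hc_weight k lam z n \<sigma> *
          (\<Prod>y\<in>?W. (\<Prod>i<k. spin_prob lam z \<sigma> (i # y)) * ?b y)"
        by (simp add: ball_vertices_Suc prod.union_disjoint ball_sphere_disjoint C[OF \<sigma>]
            prod_sphere_vertices_Suc prod.distrib mult.assoc)
      also have "(\<Prod>y\<in>?W. (\<Prod>i<k. spin_prob lam z \<sigma> (i # y)) * ?b y) =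
          (\<Prod>y\<in>?W. z y * (\<Prod>i<k. ?f (i # y)))"
        using sphere_vertices_subset by (intro prod.cong family) auto
      also have "C * hc_weight k lam z n \<sigma> * \<dots> =
          C * (\<Prod>y\<in>?W. z y) * (hc_weight k lam z n \<sigma> * (\<Prod>y\<in>?W. \<Prod>i<k. ?f (i # y)))"
        by (simp add: prod.distrib)
      also have "\<dots> = C * (\<Prod>y\<in>?W. z y) * hc_weight k lam z (Suc n) \<sigma> * (\<Prod>y\<in>?W. ?b y)"
        by (simp only: hc_weight_Suc[symmetric] mult.assoc)
      finally show ?thesis
        by (simp only: mult_right_cancel[OF less_imp_neq[OF pos, symmetric]])
    qed
    then show ?case by blast
  }
qed

lemma ex_is_gibbs:
  assumes z: "compatible k lam z" and lam: "lam > 0"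
  shows "\<exists>\<mu>. is_gibbs k lam z \<mu>"
proof -
  define \<mu> where "\<mu> = distr (coins k lam z) (config_space k) (thinned k)"
  interpret prob_space \<mu>
    unfolding \<mu>_def by (rule prob_space.prob_space_distr[OF prob_space_coins measurable_thinned])
  have sets: "sets \<mu> = sets (config_space k)" by (simp add: \<mu>_def)
  have space: "space \<mu> = hc_configs k (vertices k)" by (simp add: \<mu>_def space_config_space)
  have zpos: "z x > 0" if "x \<in> vertices k" for x
    using z that unfolding compatible_def by blast
  have "measure \<mu> (cylinder k n \<sigma>) = hc_marginal k lam z n \<sigma>"
    if \<sigma>: "\<sigma> \<in> hc_configs k (ball_vertices k n)" for n \<sigma>
  proof -
    let ?B = "ball_vertices k n"
    obtain C where C: "\<And>\<sigma>. \<sigma> \<in> hc_configs k (vertices k) \<Longrightarrow>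
        (\<Prod>x\<in>?B. spin_prob lam z \<sigma> x) = C * hc_weight k lam z n \<sigma>"
      using prod_spin_prob[OF z lam] by blast
    have proportional: "measure \<mu> (cylinder k n \<tau>) = C * hc_weight k lam z n \<tau>"
      if \<tau>: "\<tau> \<in> hc_configs k ?B" for \<tau>
    proof -
      \<comment> \<open>extend by empty vertices to an admissible configuration of the whole tree\<close>
      define \<tau>' where "\<tau>' = (\<lambda>x\<in>vertices k. if x \<in> ?B then \<tau> x else 0)"
      have \<tau>': "\<tau>' \<in> hc_configs k (vertices k)"
        unfolding hc_configs_iff
        using \<tau> by (auto simp: \<tau>'_def hc_configs_iff PiE_iff in_ball_vertices_iff)
      have agree: "\<tau>' x = \<tau> x" if "x \<in> ?B" for x
        using that ball_vertices_subset by (auto simp: \<tau>'_def)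
      have "spin_prob lam z \<tau>' x = spin_prob lam z \<tau> x" if "x \<in> ?B" for x
      proof -
        have "blocked \<tau>' x = blocked \<tau> x"
          using that agree[of "tl x"] by (cases x) (auto simp: blocked_def in_ball_vertices_iff)
        then show ?thesis using agree[OF that] by (simp add: spin_prob_def)
      qed
      moreover have "hc_weight k lam z n \<tau>' = hc_weight k lam z n \<tau>"
      proof -
        have "sphere_vertices k n \<subseteq> ?B" by (auto simp: ball_vertices_def)
        then show ?thesis
          unfolding hc_weight_def using agree
          by (intro arg_cong2[where f = "(*)"] arg_cong[where f = "\<lambda>A. lam ^ card A"] prod.cong) auto
      qed
      ultimately show ?thesis
        using measure_thinned_cylinder[OF \<tau> lam zpos] C[OF \<tau>'] by (simp add: \<mu>_def)
    qed
    have "1 = measure \<mu> (\<Union>\<tau>\<in>hc_configs k ?B. cylinder k n \<tau>)"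
    proof -
      have "(\<Union>\<tau>\<in>hc_configs k ?B. cylinder k n \<tau>) = space \<mu>"
        using restrict_hc_configs[OF _ ball_vertices_subset] by (auto simp: cylinder_def space)
      then show ?thesis by (simp add: prob_space)
    qed
    also have "\<dots> = (\<Sum>\<tau>\<in>hc_configs k ?B. measure \<mu> (cylinder k n \<tau>))"
      by (intro finite_measure_finite_Union)
        (auto simp: finite_hc_configs sets disjoint_family_on_def cylinder_in_sets, auto simp: cylinder_def)
    also have "\<dots> = C * (\<Sum>\<tau>\<in>hc_configs k ?B. hc_weight k lam z n \<tau>)"
      by (simp add: proportional sum_distrib_left)
    finally have CZ: "C * (\<Sum>\<tau>\<in>hc_configs k ?B. hc_weight k lam z n \<tau>) = 1" by simp
    then have "C = 1 / (\<Sum>\<tau>\<in>hc_configs k ?B. hc_weight k lam z n \<tau>)"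
      by (auto simp: eq_divide_eq)
    then show ?thesis by (simp add: proportional[OF \<sigma>] hc_marginal_def)
  qed
  then have "is_gibbs k lam z \<mu>"
    using z prob_space_axioms sets
    unfolding is_gibbs_def space cylinder_def config_space_def by blast
  then show ?thesis by blast
qed

text \<open>
  A translation-invariant law is only known to be constant on the tree, not on lists that are no
  vertices; this lemma lets it be replaced by a constant function.
\<close>

lemma is_gibbs_cong:
  assumes "\<And>x. x \<in> vertices k \<Longrightarrow> z x = z' x"
  shows "is_gibbs k lam z = is_gibbs k lam z'"
proof -
  have "compatible k lam z = compatible k lam z'"
  proof -
    have "(\<Prod>y\<in>succs k x. inverse (1 + lam * z y)) = (\<Prod>y\<in>succs k x. inverse (1 + lam * z' y))"
      if "x \<in> vertices k" for x
      using succs_subset[OF that] assms by (intro prod.cong) auto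
    then show ?thesis using assms by (simp add: compatible_def)
  qed
  moreover have "hc_marginal k lam z = hc_marginal k lam z'"
  proof -
    have "hc_weight k lam z n \<sigma> = hc_weight k lam z' n \<sigma>" for n \<sigma>
      unfolding hc_weight_def using sphere_vertices_subset assms
      by (intro arg_cong2[where f = "(*)"] refl prod.cong) (auto simp: boundary_weight_def subset_iff)
    then show ?thesis by (simp add: hc_marginal_def fun_eq_iff)
  qed
  ultimately show ?thesis by (simp add: is_gibbs_def fun_eq_iff)
qed

section \<open>Solutions of the two-valued system\<close>

lemma ex1_constant_law:
  fixes lam :: real
  assumes "lam > 0"
  shows "\<exists>!c. c > 0 \<and> c * (1 + lam * c) ^ k = 1"
proof (rule ex_ex1I)
  let ?f = "\<lambda>c :: real. c * (1 + lam * c) ^ k"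
  \<comment> \<open>the left side is 0 at 0, and at least 1 at 1\<close>
  have "\<exists>c\<ge>0. c \<le> 1 \<and> ?f c = 1"
    using assms by (intro IVT' continuous_intros) auto
  then obtain c where c: "c \<ge> 0" "?f c = 1" by blast
  then have "c > 0" by (cases "c = 0") simp_all
  with c show "\<exists>c>0. ?f c = 1" by blast
next
  fix c d :: real assume c: "c > 0 \<and> c * (1 + lam * c) ^ k = 1" and d: "d > 0 \<and> d * (1 + lam * d) ^ k = 1"
  have less: "x * (1 + lam * x) ^ k < y * (1 + lam * y) ^ k" if "0 < x" "x < y" for x y
    using that assms by (intro mult_less_le_imp_less power_mono zero_less_power) (auto intro: add_pos_pos)
  show "c = d"
    using less[of c d] less[of d c] c d by (cases c d rule: linorder_cases) auto
qed

text \<open>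
  The quotient argument in multiplied-out form, because the exponent \<open>m + r - k\<close> may be \<open>-1\<close>.
  Since exchanging \<open>(h, m)\<close> with \<open>(l, r)\<close> preserves the system, this also rules out \<open>h < l\<close>.
\<close>

lemma system_solution_not_less:
  fixes h l lam :: real
  assumes "m \<le> k" "r \<le> k" "m + r \<ge> k - 1" "lam > 0" "l > 0"
    and h: "h * ((1 + lam * h) ^ m * (1 + lam * l) ^ (k - m)) = 1"
    and l: "l * ((1 + lam * l) ^ r * (1 + lam * h) ^ (k - r)) = 1"
  shows "\<not> l < h"
proof
  assume "l < h"
  define H L where "H = 1 + lam * h" and "L = 1 + lam * l"
  have HL: "1 < L" "L < H" using assms \<open>l < h\<close> by (auto simp: H_def L_def)
  have eq: "h * (H ^ m * L ^ (k - m)) = l * (L ^ r * H ^ (k - r))"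
    using h l by (simp add: H_def L_def)
  have cross: "l * H < h * L"
    using \<open>l < h\<close> by (simp add: H_def L_def algebra_simps)
  have "l * (L ^ r * H ^ (k - r)) < h * (H ^ m * L ^ (k - m))"
  proof (cases "k \<le> m + r")
    case True
    \<comment> \<open>after cancelling the common powers, \<open>l * L ^ d\<close> is compared with \<open>h * H ^ d\<close>\<close>
    define d where "d = m + r - k"
    have e: "m = (k - r) + d" "r = (k - m) + d" using True assms(1,2) by (auto simp: d_def)
    have "l * L ^ d < h * H ^ d"
      using \<open>l < h\<close> \<open>l > 0\<close> HL by (intro mult_less_le_imp_less power_mono) auto
    then have "l * L ^ d * (L ^ (k - m) * H ^ (k - r)) < h * H ^ d * (L ^ (k - m) * H ^ (k - r))"
      using HL by (intro mult_strict_right_mono) auto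
    moreover have "L ^ r = L ^ (k - m) * L ^ d" "H ^ m = H ^ (k - r) * H ^ d"
      using e by (metis power_add)+
    ultimately show ?thesis by (simp add: mult_ac)
  next
    case False
    \<comment> \<open>here \<open>m + r = k - 1\<close>, and \<open>l * H\<close> is compared with \<open>h * L\<close>\<close>
    then have e: "k - r = Suc m" "k - m = Suc r" using assms(1-3) by auto
    have "l * H * (L ^ r * H ^ m) < h * L * (L ^ r * H ^ m)"
      using cross HL by (intro mult_strict_right_mono) auto
    then show ?thesis by (simp add: e mult_ac)
  qed
  with eq show False by simp
qed

lemma AGM_solutions_eq:
  assumes "m \<le> k" "r \<le> k" "m + r \<ge> k - 1" "lam > 0"
    and c: "c > 0" "c * (1 + lam * c) ^ k = 1"
  shows "AGM_solutions k m r lam = {(c, c)}"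
proof -
  have one_div: "x = 1 / p \<longleftrightarrow> x * p = 1" if "p > 0" for x p :: real
    using that by (simp add: eq_divide_eq)
  have iff: "(h, l) \<in> AGM_solutions k m r lam \<longleftrightarrow> h > 0 \<and> l > 0 \<and>
      h * ((1 + lam * h) ^ m * (1 + lam * l) ^ (k - m)) = 1 \<and>
      l * ((1 + lam * l) ^ r * (1 + lam * h) ^ (k - r)) = 1" for h l
  proof (cases "h > 0 \<and> l > 0")
    case True
    then have "1 + lam * h > 0" "1 + lam * l > 0" using \<open>lam > 0\<close> by (auto intro: add_pos_pos)
    then have "(1 + lam * h) ^ m * (1 + lam * l) ^ (k - m) > 0"
        "(1 + lam * l) ^ r * (1 + lam * h) ^ (k - r) > 0" by simp_all
    then show ?thesis unfolding AGM_solutions_def by (simp add: one_div)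
  qed (auto simp: AGM_solutions_def)
  have diag: "x ^ m * x ^ (k - m) = x ^ k" "x ^ r * x ^ (k - r) = x ^ k" for x :: real
    using assms(1,2) by (simp_all flip: power_add)
  have "h = c \<and> l = c" if "(h, l) \<in> AGM_solutions k m r lam" for h l
  proof -
    note hl = that[unfolded iff]
    have "\<not> l < h" using system_solution_not_less[of m k r lam l h] assms hl by simp
    moreover have "\<not> h < l" using system_solution_not_less[of r k m lam h l] assms hl by simp
    ultimately have "h = l" by simp
    then show ?thesis using hl c ex1_constant_law[OF \<open>lam > 0\<close>, of k] by (auto simp: diag)
  qed
  moreover have "(c, c) \<in> AGM_solutions k m r lam"
    using c by (simp add: iff diag)
  ultimately show ?thesis by (intro equalityI subsetI) force+
qed

lemma compatible_const_iff:
  assumes "lam > 0"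
  shows "compatible k lam (\<lambda>_. c) \<longleftrightarrow> c > 0 \<and> c * (1 + lam * c) ^ k = 1"
proof (cases "c > 0")
  case True
  have "compatible k lam (\<lambda>_. c) \<longleftrightarrow> c = inverse (1 + lam * c) ^ k"
    using True Nil_in_vertices[of k] unfolding compatible_def prod_succs
    by (auto simp del: Nil_in_vertices)
  moreover have "1 + lam * c > 0" using True assms by (simp add: add_pos_pos)
  ultimately show ?thesis
    using True by (simp add: power_one_over inverse_eq_divide eq_divide_eq)
next
  case False
  then show ?thesis using Nil_in_vertices[of k] by (auto simp: compatible_def simp del: Nil_in_vertices)
qed

theorem theorem1:
  fixes k m r :: nat and lam :: real and a :: "nat list \<Rightarrow> bool"
  assumes "k \<ge> 2" and "m \<le> k" and "r \<le> k"
    and "m + r \<ge> k - 1"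
    and "lam > 0"
    and "arrangement k m r a"
  shows "\<exists>c \<mu>. AGM_solutions k m r lam = {(c, c)} \<and>
               AGMs k m r lam a = {\<mu>} \<and> TIGMs k lam = {\<mu>}"
proof -
  obtain c where c: "c > 0" "c * (1 + lam * c) ^ k = 1"
    using ex1_constant_law[OF \<open>lam > 0\<close>] by blast
  have sol: "AGM_solutions k m r lam = {(c, c)}"
    using AGM_solutions_eq assms c by blast
  obtain \<mu> where \<mu>: "is_gibbs k lam (\<lambda>_. c) \<mu>"
    using ex_is_gibbs compatible_const_iff \<open>lam > 0\<close> c by blast
  have gibbs: "{\<nu>. is_gibbs k lam (\<lambda>_. c) \<nu>} = {\<mu>}"
    using \<mu> is_gibbs_unique by blast
  have "AGMs k m r lam a = {\<mu>}"
    using gibbs by (simp add: AGMs_def sol)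
  moreover have "TIGMs k lam = {\<nu>. is_gibbs k lam (\<lambda>_. c) \<nu>}"
  proof -
    have "is_gibbs k lam (\<lambda>_. c) \<nu>"
      if z: "\<forall>x\<in>vertices k. z x = d" and \<nu>: "is_gibbs k lam z \<nu>" for z d \<nu>
    proof -
      have d: "is_gibbs k lam (\<lambda>_. d) \<nu>"
        using \<nu> is_gibbs_cong[of k z "\<lambda>_. d" lam] z by simp
      then have "d > 0 \<and> d * (1 + lam * d) ^ k = 1"
        using compatible_const_iff \<open>lam > 0\<close> by (simp add: is_gibbs_def)
      then have "d = c"
        using c ex1_constant_law[OF \<open>lam > 0\<close>, of k] by blast
      with d show ?thesis by simp
    qed
    then have "TIGMs k lam \<subseteq> {\<nu>. is_gibbs k lam (\<lambda>_. c) \<nu>}"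
      unfolding TIGMs_def by (intro subsetI) (elim CollectE exE conjE, intro CollectI)
    moreover have "{\<nu>. is_gibbs k lam (\<lambda>_. c) \<nu>} \<subseteq> TIGMs k lam"
      unfolding TIGMs_def by (intro subsetI CollectI exI[of _ "\<lambda>_. c"]) simp
    ultimately show ?thesis by blast
  qed
  ultimately show ?thesis using sol gibbs by blast
qed

end
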